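(* Let $\mathbb Z_2=(\{-1,+1\},\cdot)$ and let $V_+,V_-$ be its two irreducible real representations. Let $V_{\mathrm{in}},V_{\mathrm{out}}\in\{V_+,V_-\}$, and identify $\mathrm{Hom}_{\mathbb R}(V_{\mathrm{in}},V_{\mathrm{out}})\cong\mathbb R$. (a) On $X=\{-1,1\}$: if $V_{\mathrm{in}}=V_{\mathrm{out}}$, a basis of the space of steerable kernels $K:X\to\mathrm{Hom}_{\mathbb R}(V_{\mathrm{in}},V_{\mathrm{out}})$ is given by the single kernel $f_+$; if $V_{\mathrm{in}}\ne V_{\mathrm{out}}$, a basis is given by the single kernel $f_-$. (b) On $X=\{0\}$: if $V_{\mathrm{in}}=V_{\mathrm{out}}$, a basis of the space of steerable kernels is given by the constant function with value $1$; if $V_{\mathrm{in}}\neq V_{\mathrm{out}}$, the only steerable kernel is $0$. (c) On $\mathbb R^2$: if $V_{\mathrm{in}}=V_{\mathrm{out}}$, the steerable kernels $K:\mathbb R^2\to\mathbb R$ are exactly the arbitrary left-right symmetric functions, $K(a,b)=K(-a,b)$ for all $a\ge0,b\in\mathbb R$; if $V_{\mathrm{in}}\ne V_{\mathrm{out}}$, they are exactly the arbitrary left-right antisymmetric functions, $K(-a,b)=-K(a,b)$, which in particular vanish on the line $\{(0,b):b\in\mathbb R\}$.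
   Context: $V_+=V_-=\mathbb R$ with $\rho_+(-1)=\mathrm{id}_{\mathbb R}$ and $\rho_-(-1)=-\mathrm{id}_{\mathbb R}$. $\mathbb Z_2$ acts on $X=\{-1,1\}$ by multiplication, on $X=\{0\}$ trivially, and on $\mathbb R^2$ by $s\cdot(a,b)=(sa,b)$. A steerable kernel on a $\mathbb Z_2$-space $X$ is any function $K:X\to\mathrm{Hom}_{\mathbb R}(V_{\mathrm{in}},V_{\mathrm{out}})$ with $K(sx)=\rho_{\mathrm{out}}(s)\circ K(x)\circ\rho_{\mathrm{in}}(s)^{-1}$ for all $s\in\mathbb Z_2,x\in X$. On $X=\{-1,1\}$, $f_+(x)=1$ and $f_-(x)=x$. *)

theory Defs
  imports "HOL-Analysis.Analysis" "HOL-Algebra.Group" "HOL-Library.Function_Algebras"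
begin

text \<open>
  \<open>Hom\<^sub>\<real>(V, W)\<close> is the type \<open>'v \<Rightarrow>\<^sub>L 'w\<close>: its elements are all linear maps, because
  \<open>'v\<close> is finite-dimensional.
\<close>

definition representation :: "('g, 'm) monoid_scheme \<Rightarrow> ('g \<Rightarrow> ('v::euclidean_space \<Rightarrow>\<^sub>L 'v)) \<Rightarrow> bool"
  where "representation G \<rho> \<longleftrightarrow>
    \<rho> \<one>\<^bsub>G\<^esub> = id_blinfun \<and>
    (\<forall>g\<in>carrier G. \<forall>h\<in>carrier G. \<rho> (g \<otimes>\<^bsub>G\<^esub> h) = \<rho> g o\<^sub>L \<rho> h)"

text \<open>The zero representation is excluded by the type class, which has \<open>DIM('v) \<ge> 1\<close>.\<close>

definition irreducible_representation :: "('g, 'm) monoid_scheme \<Rightarrow> ('g \<Rightarrow> ('v::euclidean_space \<Rightarrow>\<^sub>L 'v)) \<Rightarrow> bool"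
  where "irreducible_representation G \<rho> \<longleftrightarrow>
    representation G \<rho> \<and>
    (\<forall>S. subspace S \<and> (\<forall>g\<in>carrier G. blinfun_apply (\<rho> g) ` S \<subseteq> S) \<longrightarrow> S = {0} \<or> S = UNIV)"

definition isomorphic_representations ::
  "('g, 'm) monoid_scheme \<Rightarrow> ('g \<Rightarrow> ('v::euclidean_space \<Rightarrow>\<^sub>L 'v)) \<Rightarrow> ('g \<Rightarrow> ('w::euclidean_space \<Rightarrow>\<^sub>L 'w)) \<Rightarrow> bool"
  where "isomorphic_representations G \<rho> \<sigma> \<longleftrightarrow>
    (\<exists>T :: 'v \<Rightarrow>\<^sub>L 'w. bij (blinfun_apply T) \<and> (\<forall>g\<in>carrier G. T o\<^sub>L \<rho> g = \<sigma> g o\<^sub>L T))"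

text \<open>
  A function on a subset \<open>X\<close> of a type is represented by its extension by \<open>0\<close>, so that the
  functions on \<open>X\<close> form a linear subspace of the functions on the whole type.
\<close>

definition steerable_kernels ::
  "('g, 'm) monoid_scheme \<Rightarrow> 'x set \<Rightarrow> ('g \<Rightarrow> 'x \<Rightarrow> 'x) \<Rightarrow>
   ('g \<Rightarrow> ('v::euclidean_space \<Rightarrow>\<^sub>L 'v)) \<Rightarrow> ('g \<Rightarrow> ('w::euclidean_space \<Rightarrow>\<^sub>L 'w)) \<Rightarrow>
   ('x \<Rightarrow> ('v \<Rightarrow>\<^sub>L 'w)) set"
  where "steerable_kernels G X act \<rho>\<^sub>i\<^sub>n \<rho>\<^sub>o\<^sub>u\<^sub>t =
    {K. (\<forall>x. x \<notin> X \<longrightarrow> K x = 0) \<and>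
        (\<forall>s\<in>carrier G. \<forall>x\<in>X.
           blinfun_apply (K (act s x)) =
             blinfun_apply (\<rho>\<^sub>o\<^sub>u\<^sub>t s) \<circ> blinfun_apply (K x) \<circ> inv_into UNIV (blinfun_apply (\<rho>\<^sub>i\<^sub>n s)))}"

definition kernel_scale :: "real \<Rightarrow> ('x \<Rightarrow> 'w::real_vector) \<Rightarrow> 'x \<Rightarrow> 'w"
  where "kernel_scale c K = (\<lambda>x. c *\<^sub>R K x)"

lemma vector_space_kernel_scale: "vector_space kernel_scale"
  by unfold_locales (auto simp: kernel_scale_def fun_eq_iff algebra_simps)

definition is_basis_of :: "('x \<Rightarrow> 'w::real_vector) set \<Rightarrow> ('x \<Rightarrow> 'w) set \<Rightarrow> bool"
  where "is_basis_of B W \<longleftrightarrow>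
    \<not> module.dependent kernel_scale B \<and> module.span kernel_scale B = W"

lemma subspace_steerable_kernels:
  "module.subspace kernel_scale (steerable_kernels G X act \<rho>\<^sub>i\<^sub>n \<rho>\<^sub>o\<^sub>u\<^sub>t)"
proof -
  interpret vector_space "kernel_scale :: real \<Rightarrow> ('x \<Rightarrow> ('v::euclidean_space \<Rightarrow>\<^sub>L 'w::euclidean_space)) \<Rightarrow> _"
    by (rule vector_space_kernel_scale)
  show ?thesis
    by (rule subspaceI)
       (auto simp: steerable_kernels_def kernel_scale_def fun_eq_iff blinfun.bilinear_simps)
qed

text \<open>
  The identification \<open>Hom\<^sub>\<real>(\<real>, \<real>) \<cong> \<real>\<close> sends a number \<open>c\<close> to multiplication by \<open>c\<close>;
  \<open>real_kernel X k\<close> is the kernel on \<open>X\<close> corresponding to the real-valued function \<open>k\<close>.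
\<close>

definition real_kernel :: "'x set \<Rightarrow> ('x \<Rightarrow> real) \<Rightarrow> 'x \<Rightarrow> (real \<Rightarrow>\<^sub>L real)"
  where "real_kernel X k = (\<lambda>x. if x \<in> X then blinfun_mult_right (k x) else 0)"

lemma bij_blinfun_mult_right: "bij (blinfun_mult_right :: real \<Rightarrow> (real \<Rightarrow>\<^sub>L real))"
proof (rule bijI)
  show "inj (blinfun_mult_right :: real \<Rightarrow> (real \<Rightarrow>\<^sub>L real))"
    by (rule injI) (metis blinfun_mult_right.rep_eq mult.right_neutral)
  have "f = blinfun_mult_right (blinfun_apply f 1)" for f :: "real \<Rightarrow>\<^sub>L real"
  proof (rule blinfun_eqI)
    fix v :: real
    show "blinfun_apply f v = blinfun_apply (blinfun_mult_right (blinfun_apply f 1)) v"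
      using blinfun.scaleR_right[of f v 1] by simp
  qed
  then show "surj (blinfun_mult_right :: real \<Rightarrow> (real \<Rightarrow>\<^sub>L real))"
    by (rule surjI[OF sym])
qed

definition Z2 :: "real monoid"
  where "Z2 = \<lparr>carrier = {-1, 1}, mult = (*), one = 1\<rparr>"

lemma group_Z2: "group Z2"
  by (rule groupI) (auto simp: Z2_def)

definition rho_plus :: "real \<Rightarrow> (real \<Rightarrow>\<^sub>L real)"
  where "rho_plus s = id_blinfun"

definition rho_minus :: "real \<Rightarrow> (real \<Rightarrow>\<^sub>L real)"
  where "rho_minus s = (if s = -1 then - id_blinfun else id_blinfun)"

lemma subspace_real_cases: "S = {0} \<or> S = UNIV" if S: "subspace S" for S :: "real set"
proof (cases "S = {0}")
  case False
  then obtain w where w: "w \<in> S" "w \<noteq> 0"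
    using subspace_0[OF S] by blast
  have "x \<in> S" for x
    using subspace_scale[OF S w(1), of "x / w"] w(2) by simp
  then show ?thesis by blast
qed simp

lemma irreducible_rho_plus: "irreducible_representation Z2 rho_plus"
  by (auto simp: irreducible_representation_def representation_def Z2_def rho_plus_def
      dest!: subspace_real_cases intro!: blinfun_eqI)

lemma irreducible_rho_minus: "irreducible_representation Z2 rho_minus"
  by (auto simp: irreducible_representation_def representation_def Z2_def rho_minus_def
      blinfun.bilinear_simps dest!: subspace_real_cases intro!: blinfun_eqI)

lemma not_isomorphic_rho_plus_rho_minus: "\<not> isomorphic_representations Z2 rho_plus rho_minus"
proof
  assume "isomorphic_representations Z2 rho_plus rho_minus"
  then obtain T :: "real \<Rightarrow>\<^sub>L real" where T: "bij (blinfun_apply T)"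
    and eq: "T o\<^sub>L rho_plus (-1) = rho_minus (-1) o\<^sub>L T"
    by (auto simp: isomorphic_representations_def Z2_def)
  have "blinfun_apply T 1 = - blinfun_apply T 1"
    using arg_cong[OF eq, of "\<lambda>f. blinfun_apply f 1"]
    by (simp add: rho_plus_def rho_minus_def blinfun.bilinear_simps)
  then have "blinfun_apply T 1 = blinfun_apply T 0"
    by (simp add: blinfun.bilinear_simps)
  then show False
    using injD[OF bij_is_inj[OF T]] by fastforce
qed

lemma irreducible_Z2_cases:
  fixes \<rho> :: "real \<Rightarrow> ('v::euclidean_space \<Rightarrow>\<^sub>L 'v)"
  assumes irr: "irreducible_representation Z2 \<rho>"
  shows "isomorphic_representations Z2 rho_plus \<rho> \<or> isomorphic_representations Z2 rho_minus \<rho>"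
proof -
  have one: "\<rho> 1 = id_blinfun" and sq: "\<rho> (-1) o\<^sub>L \<rho> (-1) = id_blinfun"
    using irr by (auto simp: irreducible_representation_def representation_def Z2_def
        dest: bspec[where x = "-1"])
  have sq': "blinfun_apply (\<rho> (-1)) (blinfun_apply (\<rho> (-1)) v) = v" for v
    using arg_cong[OF sq, of "\<lambda>f. blinfun_apply f v"] by simp
  obtain v :: 'v where "v \<noteq> 0"
    using nonempty_Basis nonzero_Basis by blast
  have "\<exists>w c. w \<noteq> 0 \<and> (c = 1 \<or> c = -1) \<and> blinfun_apply (\<rho> (-1)) w = c *\<^sub>R w"
  proof (cases "v + blinfun_apply (\<rho> (-1)) v = 0")
    case True
    then have "blinfun_apply (\<rho> (-1)) v = (-1) *\<^sub>R v"
      by (simp add: eq_neg_iff_add_eq_0 add.commute)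
    with \<open>v \<noteq> 0\<close> show ?thesis by blast
  next
    case False
    have "blinfun_apply (\<rho> (-1)) (v + blinfun_apply (\<rho> (-1)) v) = 1 *\<^sub>R (v + blinfun_apply (\<rho> (-1)) v)"
      by (simp add: blinfun.bilinear_simps sq' add.commute)
    with False show ?thesis by blast
  qed
  then obtain w c where w: "w \<noteq> 0" and c: "c = 1 \<or> c = (-1::real)"
    and ev: "blinfun_apply (\<rho> (-1)) w = c *\<^sub>R w" by blast
  have "blinfun_apply (\<rho> g) ` span {w} \<subseteq> span {w}" if "g \<in> carrier Z2" for g
    using that ev
    by (auto simp: Z2_def one span_singleton blinfun.bilinear_simps)
  then have "span {w} = {0} \<or> span {w} = UNIV"
    using irr subspace_span by (auto simp: irreducible_representation_def)
  then have full: "span {w} = UNIV"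
    using w span_base[of w "{w}"] by auto
  define T :: "real \<Rightarrow>\<^sub>L 'v" where "T = blinfun_scaleR_left w"
  have T: "blinfun_apply T r = r *\<^sub>R w" for r
    by (simp add: T_def)
  have "bij (blinfun_apply T)"
  proof (rule bijI)
    show "inj (blinfun_apply T)" using w by (auto simp: inj_def T)
    show "surj (blinfun_apply T)" using full by (auto simp: span_singleton T)
  qed
  then show ?thesis
    using c ev one
    by (auto simp: isomorphic_representations_def Z2_def rho_plus_def rho_minus_def T
        blinfun.bilinear_simps intro!: exI[of _ T] blinfun_eqI)
qed

definition mult_act :: "real \<Rightarrow> real \<Rightarrow> real"
  where "mult_act s x = s * x"

definition trivial_act :: "real \<Rightarrow> real \<Rightarrow> real"
  where "trivial_act s x = x"

definition plane_act :: "real \<Rightarrow> real \<times> real \<Rightarrow> real \<times> real"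
  where "plane_act s = (\<lambda>(a, b). (s * a, b))"

definition f_plus :: "real \<Rightarrow> real"
  where "f_plus x = 1"

definition f_minus :: "real \<Rightarrow> real"
  where "f_minus x = x"

end

theory Submission
  imports Defs
begin

text \<open>The group element 1 imposes no condition, so steerability is a single equation, the one
  for -1. There each representation acts by a sign and is its own inverse, so conjugating
  \<open>K x\<close> multiplies it by the product of the two signs: 1 if the representations agree,
  -1 if they differ (\<open>conjugate_rho_minus_one\<close>). After identifying Hom(\<real>,
  \<real>) with \<real>, the steerable kernels on any X are therefore the real functions that are
  even, respectively odd, under the action of -1 (\<open>steerable_kernels_Z2_eq\<close>). The three
  spaces differ only in their orbits. On {-1, 1} the group acts freely and transitively, so a kernel
  is determined by its value at 1 and the space is a line. At a fixed point evenness says nothing,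
  while oddness forces the value 0. On the plane the action is the reflection in the line a = 0,
  whose points are fixed, so odd functions vanish there. \<open>is_basis_of_real_kernel\<close>
  converts the one-parameter descriptions into statements about bases.\<close>

lemma rho_plus_neq_rho_minus: "rho_plus \<noteq> rho_minus"
proof
  assume "rho_plus = rho_minus"
  then have "blinfun_apply (rho_plus (-1)) 1 = blinfun_apply (rho_minus (-1)) 1"
    by simp
  then show False
    by (simp add: rho_plus_def rho_minus_def blinfun.bilinear_simps)
qed

text \<open>Multiplication by c determines c, and off \<open>X\<close> both kernels are 0. Only the
  values on \<open>X\<close> matter, so functions that differ outside \<open>X\<close> represent the
  same kernel.\<close>

lemma real_kernel_eq_iff: "real_kernel X k = real_kernel X l \<longleftrightarrow> (\<forall>x\<in>X. k x = l x)"
  using bij_is_inj[OF bij_blinfun_mult_right] by (auto simp: real_kernel_def fun_eq_iff inj_eq)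

lemma kernel_scale_real_kernel:
  "kernel_scale c (real_kernel X k) = real_kernel X (\<lambda>x. c * k x)"
  by (auto simp: kernel_scale_def real_kernel_def fun_eq_iff blinfun.bilinear_simps intro!: blinfun_eqI)

lemma real_kernel_zero: "real_kernel X (\<lambda>_. 0) = 0"
  by (auto simp: real_kernel_def fun_eq_iff intro!: blinfun_eqI)

text \<open>A linear map from \<real> to \<real> is multiplication by its value at 1, so evaluation
  at 1 inverts the identification. The hypothesis matches the extension by 0 built into
  \<open>real_kernel\<close>.\<close>

lemma real_kernel_of_vanishing:
  assumes "\<And>x. x \<notin> X \<Longrightarrow> K x = 0"
  shows "K = real_kernel X (\<lambda>x. blinfun_apply (K x) 1)"
proof
  fix x
  obtain c where "K x = blinfun_mult_right c"
    using bij_is_surj[OF bij_blinfun_mult_right] by (metis surjD)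
  then show "K x = real_kernel X (\<lambda>x. blinfun_apply (K x) 1) x"
    using assms by (auto simp: real_kernel_def)
qed

lemma conjugate_rho_minus_one:
  fixes f :: "real \<Rightarrow>\<^sub>L real"
  assumes "\<rho>\<^sub>i\<^sub>n \<in> {rho_plus, rho_minus}" "\<rho>\<^sub>o\<^sub>u\<^sub>t \<in> {rho_plus, rho_minus}"
  shows "blinfun_apply (\<rho>\<^sub>o\<^sub>u\<^sub>t (-1)) \<circ> blinfun_apply f \<circ> inv_into UNIV (blinfun_apply (\<rho>\<^sub>i\<^sub>n (-1)))
    = blinfun_apply (if \<rho>\<^sub>i\<^sub>n = \<rho>\<^sub>o\<^sub>u\<^sub>t then f else - f)"
proof -
  have plus: "blinfun_apply (rho_plus (-1)) = id"
    by (auto simp: rho_plus_def)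
  have minus: "blinfun_apply (rho_minus (-1)) = uminus"
    by (auto simp: rho_minus_def blinfun.bilinear_simps)
  \<comment> \<open>Steerability is phrased with the set-theoretic inverse of the map; negation is
    an involution, so it is its own inverse.\<close>
  have inv_uminus: "inv_into UNIV (uminus :: real \<Rightarrow> real) = uminus"
    by (rule inv_equality) auto
  show ?thesis
    using assms rho_plus_neq_rho_minus
    by (auto simp: plus minus inv_uminus fun_eq_iff blinfun.bilinear_simps)
qed

lemma conjugate_rho_one:
  fixes f :: "real \<Rightarrow>\<^sub>L real"
  assumes "\<rho>\<^sub>i\<^sub>n \<in> {rho_plus, rho_minus}" "\<rho>\<^sub>o\<^sub>u\<^sub>t \<in> {rho_plus, rho_minus}"
  shows "blinfun_apply (\<rho>\<^sub>o\<^sub>u\<^sub>t 1) \<circ> blinfun_apply f \<circ> inv_into UNIV (blinfun_apply (\<rho>\<^sub>i\<^sub>n 1)) = blinfun_apply f"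
proof -
  have "blinfun_apply (\<rho> 1) = id" if "\<rho> \<in> {rho_plus, rho_minus}" for \<rho>
    using that by (auto simp: rho_plus_def rho_minus_def)
  then show ?thesis
    using assms by simp
qed

text \<open>The common source of all three cases. Closure of \<open>X\<close> under -1 ensures that
  \<open>real_kernel X k\<close> at \<open>act (-1) x\<close> is given by \<open>k\<close> and not
  by the default value 0.\<close>

lemma steerable_kernels_Z2_eq:
  assumes \<rho>: "\<rho>\<^sub>i\<^sub>n \<in> {rho_plus, rho_minus}" "\<rho>\<^sub>o\<^sub>u\<^sub>t \<in> {rho_plus, rho_minus}"
    and act_one: "\<And>x. x \<in> X \<Longrightarrow> act 1 x = x"
    and act_closed: "\<And>x. x \<in> X \<Longrightarrow> act (-1) x \<in> X"
  shows "steerable_kernels Z2 X act \<rho>\<^sub>i\<^sub>n \<rho>\<^sub>o\<^sub>u\<^sub>t =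
    real_kernel X ` {k. \<forall>x\<in>X. k (act (-1) x) = (if \<rho>\<^sub>i\<^sub>n = \<rho>\<^sub>o\<^sub>u\<^sub>t then k x else - k x)}"
    (is "?S = real_kernel X ` ?R")
proof -
  \<comment> \<open>The condition for s = 1 reduces to \<open>K (act 1 x) = K x\<close>, which
    \<open>act_one\<close> settles; only s = -1 remains.\<close>
  have mem_iff: "K \<in> ?S \<longleftrightarrow> (\<forall>x. x \<notin> X \<longrightarrow> K x = 0) \<and>
      (\<forall>x\<in>X. K (act (-1) x) = (if \<rho>\<^sub>i\<^sub>n = \<rho>\<^sub>o\<^sub>u\<^sub>t then K x else - K x))" for K
    by (simp only: steerable_kernels_def Z2_def mem_Collect_eq monoid.simps partial_object.simps
        ball_simps conjugate_rho_one[OF \<rho>] conjugate_rho_minus_one[OF \<rho>] blinfun_apply_inject)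
      (auto simp: act_one)
  have real_kernel_mem_iff: "real_kernel X k \<in> ?S \<longleftrightarrow> k \<in> ?R" for k
  proof -
    have "real_kernel X k (act (-1) x) = (if \<rho>\<^sub>i\<^sub>n = \<rho>\<^sub>o\<^sub>u\<^sub>t then real_kernel X k x else - real_kernel X k x)
      \<longleftrightarrow> k (act (-1) x) = (if \<rho>\<^sub>i\<^sub>n = \<rho>\<^sub>o\<^sub>u\<^sub>t then k x else - k x)" if "x \<in> X" for x
    proof -
      have "- blinfun_mult_right (k x) = (blinfun_mult_right (- k x) :: real \<Rightarrow>\<^sub>L real)"
        by (rule blinfun_eqI) (simp add: blinfun.bilinear_simps)
      then show ?thesis
        using that act_closed[OF that] bij_is_inj[OF bij_blinfun_mult_right]
        by (simp add: real_kernel_def inj_eq)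
    qed
    then show ?thesis
      unfolding mem_iff by (simp add: real_kernel_def)
  qed
  show ?thesis
  proof
    show "?S \<subseteq> real_kernel X ` ?R"
    proof
      fix K assume K: "K \<in> ?S"
      then have K_eq: "K = real_kernel X (\<lambda>x. blinfun_apply (K x) 1)"
        by (intro real_kernel_of_vanishing) (simp add: mem_iff)
      \<comment> \<open>Read backwards, \<open>real_kernel_mem_iff\<close> asks only that the kernel
        of this function be steerable, and that kernel is \<open>K\<close> itself.\<close>
      have "(\<lambda>x. blinfun_apply (K x) 1) \<in> ?R"
        unfolding real_kernel_mem_iff[symmetric] using K by (simp flip: K_eq)
      with K_eq show "K \<in> real_kernel X ` ?R"
        by (rule image_eqI)
    qed
  qed (use real_kernel_mem_iff in blast)
qed

lemma is_basis_of_singleton: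
  assumes "F \<noteq> 0"
  shows "is_basis_of {F} (range (\<lambda>c. kernel_scale c F))"
proof -
  interpret vector_space "kernel_scale :: real \<Rightarrow> ('a \<Rightarrow> 'b) \<Rightarrow> _"
    by (rule vector_space_kernel_scale)
  show ?thesis
    using assms by (simp add: is_basis_of_def span_singleton)
qed

text \<open>The point \<open>x\<close> witnesses that the kernel of \<open>k\<close> is nonzero,
  hence independent; the condition on \<open>R\<close> says that its image is exactly the line
  through that kernel.\<close>

lemma is_basis_of_real_kernel:
  assumes "x \<in> X" "k x \<noteq> 0"
    and "\<And>l. l \<in> R \<longleftrightarrow> (\<exists>c. \<forall>x\<in>X. l x = c * k x)"
  shows "is_basis_of {real_kernel X k} (real_kernel X ` R)"
proof -
  have "real_kernel X k \<noteq> real_kernel X (\<lambda>_. 0)"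
    using assms(1,2) by (auto simp: real_kernel_eq_iff)
  moreover have "real_kernel X ` R = range (\<lambda>c. kernel_scale c (real_kernel X k))"
  proof (intro equalityI subsetI)
    fix K assume "K \<in> real_kernel X ` R"
    then obtain l c where "K = real_kernel X l" "\<forall>x\<in>X. l x = c * k x"
      using assms(3) by blast
    then have "K = kernel_scale c (real_kernel X k)"
      by (simp add: kernel_scale_real_kernel real_kernel_eq_iff)
    then show "K \<in> range (\<lambda>c. kernel_scale c (real_kernel X k))"
      by blast
  next
    fix K assume "K \<in> range (\<lambda>c. kernel_scale c (real_kernel X k))"
    then obtain c where "K = real_kernel X (\<lambda>x. c * k x)"
      by (auto simp: kernel_scale_real_kernel)
    then show "K \<in> real_kernel X ` R"
      using assms(3) by blast
  qed
  ultimately show ?thesis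
    using is_basis_of_singleton[of "real_kernel X k"] by (simp add: real_kernel_zero)
qed

theorem mainTheorem5:
  fixes \<rho>\<^sub>i\<^sub>n \<rho>\<^sub>o\<^sub>u\<^sub>t :: "real \<Rightarrow> (real \<Rightarrow>\<^sub>L real)"
  assumes "\<rho>\<^sub>i\<^sub>n \<in> {rho_plus, rho_minus}" and "\<rho>\<^sub>o\<^sub>u\<^sub>t \<in> {rho_plus, rho_minus}"
  shows
    "((\<rho>\<^sub>i\<^sub>n = \<rho>\<^sub>o\<^sub>u\<^sub>t \<longrightarrow>
        is_basis_of {real_kernel {-1, 1} f_plus}
          (steerable_kernels Z2 {-1, 1} mult_act \<rho>\<^sub>i\<^sub>n \<rho>\<^sub>o\<^sub>u\<^sub>t)) \<and>
      (\<rho>\<^sub>i\<^sub>n \<noteq> \<rho>\<^sub>o\<^sub>u\<^sub>t \<longrightarrow>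
        is_basis_of {real_kernel {-1, 1} f_minus}
          (steerable_kernels Z2 {-1, 1} mult_act \<rho>\<^sub>i\<^sub>n \<rho>\<^sub>o\<^sub>u\<^sub>t))) \<and>
     ((\<rho>\<^sub>i\<^sub>n = \<rho>\<^sub>o\<^sub>u\<^sub>t \<longrightarrow>
        is_basis_of {real_kernel {0} (\<lambda>_. 1)}
          (steerable_kernels Z2 {0} trivial_act \<rho>\<^sub>i\<^sub>n \<rho>\<^sub>o\<^sub>u\<^sub>t)) \<and>
      (\<rho>\<^sub>i\<^sub>n \<noteq> \<rho>\<^sub>o\<^sub>u\<^sub>t \<longrightarrow>
        steerable_kernels Z2 {0} trivial_act \<rho>\<^sub>i\<^sub>n \<rho>\<^sub>o\<^sub>u\<^sub>t = {0})) \<and>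
     ((\<rho>\<^sub>i\<^sub>n = \<rho>\<^sub>o\<^sub>u\<^sub>t \<longrightarrow>
        steerable_kernels Z2 UNIV plane_act \<rho>\<^sub>i\<^sub>n \<rho>\<^sub>o\<^sub>u\<^sub>t =
          real_kernel UNIV ` {k. \<forall>a\<ge>0. \<forall>b. k (a, b) = k (-a, b)}) \<and>
      (\<rho>\<^sub>i\<^sub>n \<noteq> \<rho>\<^sub>o\<^sub>u\<^sub>t \<longrightarrow>
        steerable_kernels Z2 UNIV plane_act \<rho>\<^sub>i\<^sub>n \<rho>\<^sub>o\<^sub>u\<^sub>t =
          real_kernel UNIV ` {k. \<forall>a b. k (-a, b) = - k (a, b)} \<and>
        (\<forall>k. real_kernel UNIV k \<in> steerable_kernels Z2 UNIV plane_act \<rho>\<^sub>i\<^sub>n \<rho>\<^sub>o\<^sub>u\<^sub>t \<longrightarrow>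
           (\<forall>b. k (0, b) = 0))))"
proof (intro conjI impI)
  note eq = steerable_kernels_Z2_eq[OF assms]
  have two: "steerable_kernels Z2 {-1, 1} mult_act \<rho>\<^sub>i\<^sub>n \<rho>\<^sub>o\<^sub>u\<^sub>t =
      real_kernel {-1, 1} ` {k. k (-1) = (if \<rho>\<^sub>i\<^sub>n = \<rho>\<^sub>o\<^sub>u\<^sub>t then k 1 else - k 1)}"
    \<comment> \<open>The points 1 and -1 form one orbit and yield the same equation, since the sign
      squares to 1.\<close>
    by (subst eq) (auto simp: mult_act_def intro!: arg_cong[where f = "image _"])
  have point: "steerable_kernels Z2 {0} trivial_act \<rho>\<^sub>i\<^sub>n \<rho>\<^sub>o\<^sub>u\<^sub>t =
      real_kernel {0} ` {k. k 0 = (if \<rho>\<^sub>i\<^sub>n = \<rho>\<^sub>o\<^sub>u\<^sub>t then k 0 else - k 0)}"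
    by (subst eq) (simp_all add: trivial_act_def)
  have plane: "steerable_kernels Z2 UNIV plane_act \<rho>\<^sub>i\<^sub>n \<rho>\<^sub>o\<^sub>u\<^sub>t =
      real_kernel UNIV ` {k. \<forall>a b. k (-a, b) = (if \<rho>\<^sub>i\<^sub>n = \<rho>\<^sub>o\<^sub>u\<^sub>t then k (a, b) else - k (a, b))}"
    by (subst eq) (simp_all add: plane_act_def split_paired_All)
  show "is_basis_of {real_kernel {-1, 1} f_plus}
      (steerable_kernels Z2 {-1, 1} mult_act \<rho>\<^sub>i\<^sub>n \<rho>\<^sub>o\<^sub>u\<^sub>t)" if "\<rho>\<^sub>i\<^sub>n = \<rho>\<^sub>o\<^sub>u\<^sub>t"
    unfolding two using that
    \<comment> \<open>The coefficient of an even function \<open>l\<close> is \<open>l 1\<close>;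
      the same choice works for odd functions and \<open>f_minus\<close>.\<close>
    by (intro is_basis_of_real_kernel[where x = 1]) (auto simp: f_plus_def)
  show "is_basis_of {real_kernel {-1, 1} f_minus}
      (steerable_kernels Z2 {-1, 1} mult_act \<rho>\<^sub>i\<^sub>n \<rho>\<^sub>o\<^sub>u\<^sub>t)" if "\<rho>\<^sub>i\<^sub>n \<noteq> \<rho>\<^sub>o\<^sub>u\<^sub>t"
    unfolding two using that
    by (intro is_basis_of_real_kernel[where x = 1]) (auto simp: f_minus_def)
  show "is_basis_of {real_kernel {0} (\<lambda>_. 1)}
      (steerable_kernels Z2 {0} trivial_act \<rho>\<^sub>i\<^sub>n \<rho>\<^sub>o\<^sub>u\<^sub>t)" if "\<rho>\<^sub>i\<^sub>n = \<rho>\<^sub>o\<^sub>u\<^sub>t"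
    unfolding point using that
    by (intro is_basis_of_real_kernel[where x = 0]) auto
  show "steerable_kernels Z2 {0} trivial_act \<rho>\<^sub>i\<^sub>n \<rho>\<^sub>o\<^sub>u\<^sub>t = {0}" if "\<rho>\<^sub>i\<^sub>n \<noteq> \<rho>\<^sub>o\<^sub>u\<^sub>t"
  proof -
    have zero: "real_kernel {0} k = 0 \<longleftrightarrow> k 0 = 0" for k :: "real \<Rightarrow> real"
      using real_kernel_eq_iff[of "{0}" k "\<lambda>_. 0"] by (simp add: real_kernel_zero)
    \<comment> \<open>A real number equal to its own negative is 0.\<close>
    have "steerable_kernels Z2 {0} trivial_act \<rho>\<^sub>i\<^sub>n \<rho>\<^sub>o\<^sub>u\<^sub>t = real_kernel {0} ` {k. k 0 = 0}"
      unfolding point using that by (auto intro!: arg_cong[where f = "image _"])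
    also have "\<dots> = {0}"
      using zero[of "\<lambda>_. 0"] by (auto simp: zero intro!: image_eqI[where x = "\<lambda>_. 0"])
    finally show ?thesis .
  qed
  show "steerable_kernels Z2 UNIV plane_act \<rho>\<^sub>i\<^sub>n \<rho>\<^sub>o\<^sub>u\<^sub>t =
      real_kernel UNIV ` {k. \<forall>a\<ge>0. \<forall>b. k (a, b) = k (-a, b)}" if "\<rho>\<^sub>i\<^sub>n = \<rho>\<^sub>o\<^sub>u\<^sub>t"
  proof -
    \<comment> \<open>For negative a, the condition at -a is the same equation read from right to
      left.\<close>
    have "(\<forall>a b. k (-a, b) = k (a, b)) \<longleftrightarrow> (\<forall>a\<ge>0. \<forall>b. k (a, b) = k (-a, b))"
      for k :: "real \<times> real \<Rightarrow> real"
      by (metis linear minus_minus neg_0_le_iff_le)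
    then show ?thesis
      unfolding plane using that by simp
  qed
  show antisym: "steerable_kernels Z2 UNIV plane_act \<rho>\<^sub>i\<^sub>n \<rho>\<^sub>o\<^sub>u\<^sub>t =
      real_kernel UNIV ` {k. \<forall>a b. k (-a, b) = - k (a, b)}" if "\<rho>\<^sub>i\<^sub>n \<noteq> \<rho>\<^sub>o\<^sub>u\<^sub>t"
    unfolding plane using that by simp
  show "\<forall>k. real_kernel UNIV k \<in> steerable_kernels Z2 UNIV plane_act \<rho>\<^sub>i\<^sub>n \<rho>\<^sub>o\<^sub>u\<^sub>t \<longrightarrow>
      (\<forall>b. k (0, b) = 0)" if "\<rho>\<^sub>i\<^sub>n \<noteq> \<rho>\<^sub>o\<^sub>u\<^sub>t"
  proof (intro allI impI)
    note neq = that
    fix k b assume "real_kernel UNIV k \<in> steerable_kernels Z2 UNIV plane_act \<rho>\<^sub>i\<^sub>n \<rho>\<^sub>o\<^sub>u\<^sub>t"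
    then obtain l where "real_kernel UNIV k = real_kernel UNIV l" "\<forall>a b. l (-a, b) = - l (a, b)"
      unfolding antisym[OF neq] by blast
    \<comment> \<open>On all of the plane \<open>real_kernel\<close> is injective, so
      \<open>k\<close> agrees with \<open>l\<close>; the argument is written \<open>- 0\<close> to
      match antisymmetry at a = 0.\<close>
    then have "k (- 0, b) = - k (0, b)"
      unfolding real_kernel_eq_iff by (metis UNIV_I)
    then show "k (0, b) = 0" by simp
  qed
qed

end
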